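(* A subset $\mathcal{C}$ of a complete lattice $L$ is a connectivity in $L$ if and only if for every element $x\in L$, each element of $\mathcal{C}\cap x^\downarrow$ is below a unique $\mathcal{C}$-component of $x$.
   Context: For $x\in L$, $x^\downarrow=\{y\in L\mid y\leqslant x\}$. The $\mathcal{C}$-components of $x$ are the maximal elements of $\mathcal{C}\cap x^\downarrow$. In a poset $P$, a mail is a non-empty subset of $P$ having a common lower bound in $P$. A subset $M$ of $P$ is mail-connected if $M\neq\varnothing$ and for any $x,y\in M$ there is a sequence $s_1,\dots,s_n\in M$ with $s_1=x$, $s_n=y$ and each $\{s_i,s_{i+1}\}$ ($1\le i\le n-1$) a mail in $P$. A subset $\mathcal{C}$ of a complete lattice $L$ is a connectivity in $L$ if it is a subchainmail of $L$, i.e., for every subset $M\subseteq\mathcal{C}$ that is mail-connected in the poset $\mathcal{C}$ (with the induced order, so common lower bounds are taken in $\mathcal{C}$), the join of $M$ in $L$ belongs to $\mathcal{C}$. *)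

theory Defs
  imports Main
begin

text \<open>A poset is given by a carrier set \<open>P\<close> with the order induced from its ambient type.\<close>

definition mail :: "'a::order set \<Rightarrow> 'a set \<Rightarrow> bool" where
  "mail P A \<longleftrightarrow> A \<subseteq> P \<and> A \<noteq> {} \<and> (\<exists>l\<in>P. \<forall>a\<in>A. l \<le> a)"

definition mail_connected :: "'a::order set \<Rightarrow> 'a set \<Rightarrow> bool" where
  "mail_connected P M \<longleftrightarrow> M \<subseteq> P \<and> M \<noteq> {} \<and>
     (\<forall>x\<in>M. \<forall>y\<in>M. \<exists>s. s \<noteq> [] \<and> set s \<subseteq> M \<and> hd s = x \<and> last s = y \<and>
        (\<forall>i. Suc i < length s \<longrightarrow> mail P {s ! i, s ! Suc i}))"

text \<open>The complete lattice is the whole type; lower bounds are taken in \<open>C\<close>, joins in the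
  ambient lattice.\<close>

definition connectivity :: "'a::complete_lattice set \<Rightarrow> bool" where
  "connectivity C \<longleftrightarrow> (\<forall>M. M \<subseteq> C \<and> mail_connected C M \<longrightarrow> Sup M \<in> C)"

definition components :: "'a::order set \<Rightarrow> 'a \<Rightarrow> 'a set" where
  "components C x = {k \<in> C \<inter> {..x}. \<forall>d\<in>C \<inter> {..x}. k \<le> d \<longrightarrow> d = k}"

end

theory Submission
  imports Defs
begin

text \<open>
  If \<open>C\<close> is a connectivity and \<open>c \<in> C\<close> lies below \<open>x\<close>, then the component above \<open>c\<close> is the join
  of all elements reachable from \<open>c\<close> by a chain of mails inside \<open>C \<inter> {..x}\<close>: every element of \<open>C\<close>
  between \<open>c\<close> and \<open>x\<close> forms a mail with \<open>c\<close>, so it is reachable. Conversely, let \<open>M\<close> be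
  mail-connected with join \<open>x\<close>. Two members of a mail share a lower bound in \<open>C\<close>, so by uniqueness
  their components of \<open>x\<close> agree; hence a single component bounds all of \<open>M\<close>, and it equals \<open>x\<close>.
\<close>

text \<open>Both endpoints are restricted to \<open>M\<close>, but the common lower bound may be any
  element of \<open>P\<close>. Chains of mails thus become \<open>rtranclp\<close>, with its
  induction rule.\<close>

definition mail_step :: "'a::order set \<Rightarrow> 'a set \<Rightarrow> 'a \<Rightarrow> 'a \<Rightarrow> bool" where
  "mail_step P M a b \<longleftrightarrow> a \<in> M \<and> b \<in> M \<and> mail P {a, b}"

lemma mail_pair_iff:
  "mail P {a, b} \<longleftrightarrow> a \<in> P \<and> b \<in> P \<and> (\<exists>l\<in>P. l \<le> a \<and> l \<le> b)"
  by (auto simp: mail_def)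

lemma mail_step_sym: "mail_step P M a b \<Longrightarrow> mail_step P M b a"
  by (auto simp: mail_step_def insert_commute)

text \<open>Induction on the closure extends a list at its end; conversely, induction on the list
  peels steps off its head. Since the closure is reflexive even outside \<open>M\<close>, the
  one-element list \<open>[x]\<close> requires \<open>x \<in> M\<close>.\<close>

lemma mail_steps_iff_list:
  assumes "x \<in> M"
  shows "(mail_step P M)\<^sup>*\<^sup>* x y \<longleftrightarrow>
    (\<exists>s. s \<noteq> [] \<and> set s \<subseteq> M \<and> hd s = x \<and> last s = y \<and>
      (\<forall>i. Suc i < length s \<longrightarrow> mail P {s ! i, s ! Suc i}))"
proof -
  \<comment> \<open>\<open>successively\<close> is the recursive form of the indexed condition and
    suits both inductions; the indices return only at the end.\<close>
  have "(\<exists>s. s \<noteq> [] \<and> set s \<subseteq> M \<and> hd s = x \<and> last s = y \<and>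
      successively (\<lambda>a b. mail P {a, b}) s)"
    if "(mail_step P M)\<^sup>*\<^sup>* x y"
    using that
  proof induction
    case base
    show ?case using assms by (intro exI[of _ "[x]"]) simp
  next
    case (step y z)
    then obtain s where "s \<noteq> []" "set s \<subseteq> M" "hd s = x" "last s = y"
      "successively (\<lambda>a b. mail P {a, b}) s"
      by blast
    then show ?case using step.hyps(2)
      by (intro exI[of _ "s @ [z]"]) (auto simp: mail_step_def successively_append_iff)
  qed
  moreover have "(mail_step P M)\<^sup>*\<^sup>* (hd s) (last s)"
    if "s \<noteq> []" "set s \<subseteq> M" "successively (\<lambda>a b. mail P {a, b}) s" for s
    using that
  proof (induction s rule: induct_list012)
    case (3 a b s)
    then have "mail_step P M a b" by (simp add: mail_step_def)
    moreover have "(mail_step P M)\<^sup>*\<^sup>* b (last (b # s))"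
      using 3 by simp
    ultimately show ?case by (simp add: converse_rtranclp_into_rtranclp)
  qed auto
  ultimately have "(mail_step P M)\<^sup>*\<^sup>* x y \<longleftrightarrow>
    (\<exists>s. s \<noteq> [] \<and> set s \<subseteq> M \<and> hd s = x \<and> last s = y \<and> successively (\<lambda>a b. mail P {a, b}) s)"
    by metis
  then show ?thesis
    by (simp only: successively_conv_nth)
qed

lemma mail_connected_iff_steps:
  "mail_connected P M \<longleftrightarrow> M \<subseteq> P \<and> M \<noteq> {} \<and> (\<forall>x\<in>M. \<forall>y\<in>M. (mail_step P M)\<^sup>*\<^sup>* x y)"
  unfolding mail_connected_def by (simp add: mail_steps_iff_list)

text \<open>Every vertex of a chain starting at \<open>c\<close> is itself reachable, so the chain
  already runs inside the reachable set. As steps are symmetric, any two reachable elements are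
  linked through \<open>c\<close>.\<close>

lemma mail_connected_reachable:
  assumes "A \<subseteq> P" "c \<in> A"
  shows "mail_connected P {d. (mail_step P A)\<^sup>*\<^sup>* c d}" (is "mail_connected P ?M")
proof -
  have sub: "d \<in> A" if "(mail_step P A)\<^sup>*\<^sup>* c d" for d
    using that assms(2) by induction (auto simp: mail_step_def)
  have from_c: "(mail_step P ?M)\<^sup>*\<^sup>* c d" if "(mail_step P A)\<^sup>*\<^sup>* c d" for d
    using that
  proof induction
    case (step y z)
    moreover have "(mail_step P A)\<^sup>*\<^sup>* c z"
      using step.hyps by (rule rtranclp.rtrancl_into_rtrancl)
    ultimately have "mail_step P ?M y z"
      by (simp add: mail_step_def)
    with step.IH show ?case by simp
  qed simp
  have "symp (mail_step P ?M)"
    by (rule sympI) (rule mail_step_sym)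
  then have symp: "symp (mail_step P ?M)\<^sup>*\<^sup>*"
    by (rule symp_rtranclp)
  have "(mail_step P ?M)\<^sup>*\<^sup>* x y" if "x \<in> ?M" "y \<in> ?M" for x y
  proof -
    have "(mail_step P ?M)\<^sup>*\<^sup>* x c"
      using symp from_c[OF that(1)[unfolded mem_Collect_eq]] by (rule sympD)
    also have "(mail_step P ?M)\<^sup>*\<^sup>* c y"
      using that(2)[unfolded mem_Collect_eq] by (rule from_c)
    finally show ?thesis .
  qed
  moreover have "?M \<subseteq> P" "?M \<noteq> {}"
    using sub assms(1) by auto
  ultimately show ?thesis
    by (simp add: mail_connected_iff_steps)
qed

lemma connectivity_ex1_component:
  assumes C: "connectivity C" and c: "c \<in> C \<inter> {..x}"
  shows "\<exists>!k. k \<in> components C x \<and> c \<le> k"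
proof -
  let ?A = "C \<inter> {..x}"
  define M where "M = {d. (mail_step C ?A)\<^sup>*\<^sup>* c d}"
  have conn: "mail_connected C M"
    unfolding M_def using c by (intro mail_connected_reachable) auto
  have sub: "d \<in> ?A" if "d \<in> M" for d
    using that[unfolded M_def mem_Collect_eq] c by induction (auto simp: mail_step_def)
  have mem: "d \<in> M" if "d \<in> ?A" "c \<le> d" for d
  proof -
    \<comment> \<open>The common lower bound in \<open>C\<close> is \<open>c\<close> itself.\<close>
    have "mail_step C ?A c d"
      using c that by (auto simp: mail_step_def mail_pair_iff)
    then show ?thesis by (auto simp: M_def)
  qed
  have k: "Sup M \<in> ?A"
    using C conn sub by (auto simp: connectivity_def intro: Sup_least)
  have ck: "c \<le> Sup M"
    using mem[OF c] by (simp add: Sup_upper)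
  have top: "d \<le> Sup M" if "d \<in> ?A" "c \<le> d" for d
    using mem[OF that] by (rule Sup_upper)
  show ?thesis
  proof (rule ex1I[of _ "Sup M"])
    \<comment> \<open>An element of \<open>?A\<close> above \<open>Sup M\<close> is also above
      \<open>c\<close>, so \<open>top\<close> bounds it by \<open>Sup M\<close>; this gives
      maximality.\<close>
    show "Sup M \<in> components C x \<and> c \<le> Sup M"
      unfolding components_def
      using k ck top order_trans[OF ck] by (blast intro: antisym)
    \<comment> \<open>By \<open>top\<close>, \<open>k\<close> lies below \<open>Sup M\<close>, which
      is in \<open>?A\<close>; maximality of \<open>k\<close> forces equality.\<close>
    show "k = Sup M" if "k \<in> components C x \<and> c \<le> k" for k
      using that k top[of k] by (auto simp: components_def)
  qed
qed

lemma connectivity_if_ex1_component: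
  fixes C :: "'a::complete_lattice set"
  assumes ex1: "\<And>x c. c \<in> C \<inter> {..x} \<Longrightarrow> \<exists>!k. k \<in> components C x \<and> c \<le> k"
  shows "connectivity C"
  unfolding connectivity_def
proof (intro allI impI, elim conjE)
  fix M assume M: "M \<subseteq> C" and conn: "mail_connected C M"
  have below: "d \<in> C \<inter> {..Sup M}" if "d \<in> M" for d
    using that M by (auto intro: Sup_upper)
  obtain c where c: "c \<in> M"
    using conn by (auto simp: mail_connected_def)
  obtain k where k: "k \<in> components C (Sup M)" "c \<le> k"
    using ex1[OF below[OF c]] by blast
  have "d \<le> k" if "(mail_step C M)\<^sup>*\<^sup>* c d" for d
    using that
  proof induction
    case base
    show ?case by (rule k(2))
  next
    case (step a b)
    then obtain l where l: "l \<in> C" "l \<le> a" "l \<le> b" and ab: "a \<in> M" "b \<in> M"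
      by (auto simp: mail_step_def mail_pair_iff)
    obtain k' where k': "k' \<in> components C (Sup M)" "b \<le> k'"
      using ex1[OF below[OF ab(2)]] by blast
    \<comment> \<open>Uniqueness is applied to \<open>l\<close>, which lies below \<open>k\<close>
      through \<open>a\<close> and below \<open>k'\<close> through \<open>b\<close>.\<close>
    have "l \<in> C \<inter> {..Sup M}"
      using l below[OF ab(1)] by auto
    moreover have "l \<le> k" "l \<le> k'"
      using l step.IH k'(2) by (auto intro: order_trans)
    ultimately have "k' = k"
      using ex1[of l "Sup M"] k(1) k'(1) by blast
    with k'(2) show ?case by simp
  qed
  then have "Sup M \<le> k"
    using conn c by (auto simp: mail_connected_iff_steps intro: Sup_least)
  \<comment> \<open>As a component of \<open>Sup M\<close>, \<open>k\<close> also lies below it, so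
    \<open>Sup M\<close> equals \<open>k\<close>, a member of \<open>C\<close>.\<close>
  then show "Sup M \<in> C"
    using k(1) antisym[of "Sup M" k] by (auto simp: components_def)
qed

theorem theorem27:
  fixes C :: "'a::complete_lattice set"
  shows "connectivity C \<longleftrightarrow>
    (\<forall>x. \<forall>c\<in>C \<inter> {..x}. \<exists>!k. k \<in> components C x \<and> c \<le> k)"
proof
  assume "connectivity C"
  then show "\<forall>x. \<forall>c\<in>C \<inter> {..x}. \<exists>!k. k \<in> components C x \<and> c \<le> k"
    by (intro allI ballI connectivity_ex1_component)
next
  assume ex1: "\<forall>x. \<forall>c\<in>C \<inter> {..x}. \<exists>!k. k \<in> components C x \<and> c \<le> k"
  show "connectivity C"
    using ex1[rule_format] by (rule connectivity_if_ex1_component)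
qed

end
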